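(* Let $f$ be as in the context. The sequences $\{x_k\}_{k=0}^\infty$, $\{\phi_k(x)\}_{k=0}^\infty$ and $\{\alpha_k\}_{k=0}^\infty$ generated by the algorithm ASUESA (described in the context), from any initial point $x_0\in\mathbb{R}^n$, form an Underestimate Sequence (UES) of $f$.
   Context: Setting (smooth case): $f:\mathbb{R}^n\to\mathbb{R}$ is continuously differentiable, $\mu$-strongly convex and $L$-smooth with $L>\mu>0$, i.e. for all $x,y\in\mathbb{R}^n$ (Euclidean norm): $f(x)\ge f(y)+\langle\nabla f(y),x-y\rangle+\frac{\mu}{2}\|x-y\|^2$ and $f(x)\le f(y)+\langle\nabla f(y),x-y\rangle+\frac{L}{2}\|x-y\|^2$. For a point $y$: $y^{++}:=y-\frac1\mu\nabla f(y)$. For $x,y\in\mathbb{R}^n$ put $\phi(x;y):=f(y)-\frac{1}{2\mu}\|\nabla f(y)\|^2+\frac{\mu}{2}\|x-y^{++}\|^2$. Algorithm ASUESA (run without its stopping test, so that infinite sequences are produced): given $x_0$, set $\alpha_k=\sqrt{\mu/L}$ and $\beta_k=\frac{1}{1+\alpha_k}$ for all $k\ge0$, $v_0=x_0^{++}$ and $\phi_0(x):=\phi(x;x_0)$. For $k=0,1,2,\dots$: set $y_k=\beta_k x_k+(1-\beta_k)v_k$; $x_{k+1}=y_k-\frac1L\nabla f(y_k)$; $v_{k+1}=(1-\alpha_k)v_k+\alpha_k y_k^{++}$; $\phi_{k+1}(x):=(1-\alpha_k)\phi_k(x)+\alpha_k\phi(x;y_k)$. Definition (UES). A series of sequences $\{x_k\}_{k=0}^\infty\subset\mathbb{R}^n$,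 $\{\phi_k(x)\}_{k=0}^\infty$ (real-valued functions on $\mathbb{R}^n$, each attaining its minimum) and $\{\alpha_k\}_{k=0}^\infty$ with $\alpha_k\in(0,1)$ for all $k\ge0$ is called an Underestimate Sequence (UES) of a function $F:\mathbb{R}^n\to\mathbb{R}$ if for all $x\in\mathbb{R}^n$ and all $k\ge0$: (i) $\phi_k(x)\le F(x)$; and (ii) $F(x_{k+1})-\phi_{k+1}^*\le(1-\alpha_k)(F(x_k)-\phi_k^* )$, where $\phi_k^*:=\min_x\phi_k(x)$. Here $F=f$. *)

theory Defs
  imports "HOL-Analysis.Analysis"
begin

definition grad :: "('a::real_inner \<Rightarrow> real) \<Rightarrow> 'a \<Rightarrow> 'a" where
  "grad f x = (THE D. GDERIV f x :> D)"

lemma grad_eqI: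
  fixes f :: "'a::real_inner \<Rightarrow> real"
  assumes "GDERIV f x :> D"
  shows "grad f x = D"
  unfolding grad_def
proof (rule the_equality)
  show "GDERIV f x :> D" by (fact assms)
next
  fix D' assume "GDERIV f x :> D'"
  with assms have "(\<lambda>h. h \<bullet> D') = (\<lambda>h. h \<bullet> D)"
    unfolding gderiv_def by (rule has_derivative_unique[rotated])
  then have "(D' - D) \<bullet> D' = (D' - D) \<bullet> D" by metis
  then have "(D' - D) \<bullet> (D' - D) = 0" by (simp add: inner_diff_right)
  then show "D' = D" by simp
qed

definition continuously_differentiable :: "('a::real_inner \<Rightarrow> real) \<Rightarrow> bool" where
  "continuously_differentiable f \<longleftrightarrow>
     (\<forall>x. \<exists>D. GDERIV f x :> D) \<and> continuous_on UNIV (grad f)"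

definition strongly_convex :: "real \<Rightarrow> ('a::real_inner \<Rightarrow> real) \<Rightarrow> bool" where
  "strongly_convex \<mu> f \<longleftrightarrow>
     (\<forall>x y. f x \<ge> f y + grad f y \<bullet> (x - y) + \<mu> / 2 * (norm (x - y))\<^sup>2)"

definition smooth :: "real \<Rightarrow> ('a::real_inner \<Rightarrow> real) \<Rightarrow> bool" where
  "smooth L f \<longleftrightarrow>
     (\<forall>x y. f x \<le> f y + grad f y \<bullet> (x - y) + L / 2 * (norm (x - y))\<^sup>2)"

text \<open>Written \<open>y\<^sup>+\<^sup>+\<close> in the literature.\<close>
definition long_step :: "('a::real_inner \<Rightarrow> real) \<Rightarrow> real \<Rightarrow> 'a \<Rightarrow> 'a" where
  "long_step f \<mu> y = y - (1 / \<mu>) *\<^sub>R grad f y"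

text \<open>This is \<open>\<phi>(x; y)\<close>; the base point \<open>y\<close> is the first of the two
  vector arguments, so that \<open>lower_model f \<mu> y\<close> is the function \<open>x \<mapsto> \<phi>(x; y)\<close>.\<close>
definition lower_model :: "('a::real_inner \<Rightarrow> real) \<Rightarrow> real \<Rightarrow> 'a \<Rightarrow> 'a \<Rightarrow> real" where
  "lower_model f \<mu> y x =
     f y - 1 / (2 * \<mu>) * (norm (grad f y))\<^sup>2 + \<mu> / 2 * (norm (x - long_step f \<mu> y))\<^sup>2"

definition asuesa_alpha :: "real \<Rightarrow> real \<Rightarrow> nat \<Rightarrow> real" where
  "asuesa_alpha \<mu> L k = sqrt (\<mu> / L)"

definition asuesa_beta :: "real \<Rightarrow> real \<Rightarrow> nat \<Rightarrow> real" where
  "asuesa_beta \<mu> L k = 1 / (1 + asuesa_alpha \<mu> L k)"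

text \<open>The pairs \<open>(x\<^sub>k, v\<^sub>k)\<close>; the point \<open>y\<^sub>k\<close> is a function of them.\<close>
primrec asuesa_xv ::
  "('a::real_inner \<Rightarrow> real) \<Rightarrow> real \<Rightarrow> real \<Rightarrow> 'a \<Rightarrow> nat \<Rightarrow> 'a \<times> 'a" where
  "asuesa_xv f \<mu> L x0 0 = (x0, long_step f \<mu> x0)"
| "asuesa_xv f \<mu> L x0 (Suc k) =
     (let (x, v) = asuesa_xv f \<mu> L x0 k;
          \<alpha> = asuesa_alpha \<mu> L k;
          \<beta> = asuesa_beta \<mu> L k;
          y = \<beta> *\<^sub>R x + (1 - \<beta>) *\<^sub>R v
      in (y - (1 / L) *\<^sub>R grad f y, (1 - \<alpha>) *\<^sub>R v + \<alpha> *\<^sub>R long_step f \<mu> y))"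

definition asuesa_x :: "('a::real_inner \<Rightarrow> real) \<Rightarrow> real \<Rightarrow> real \<Rightarrow> 'a \<Rightarrow> nat \<Rightarrow> 'a" where
  "asuesa_x f \<mu> L x0 k = fst (asuesa_xv f \<mu> L x0 k)"

definition asuesa_v :: "('a::real_inner \<Rightarrow> real) \<Rightarrow> real \<Rightarrow> real \<Rightarrow> 'a \<Rightarrow> nat \<Rightarrow> 'a" where
  "asuesa_v f \<mu> L x0 k = snd (asuesa_xv f \<mu> L x0 k)"

definition asuesa_y :: "('a::real_inner \<Rightarrow> real) \<Rightarrow> real \<Rightarrow> real \<Rightarrow> 'a \<Rightarrow> nat \<Rightarrow> 'a" where
  "asuesa_y f \<mu> L x0 k =
     asuesa_beta \<mu> L k *\<^sub>R asuesa_x f \<mu> L x0 k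
     + (1 - asuesa_beta \<mu> L k) *\<^sub>R asuesa_v f \<mu> L x0 k"

lemma asuesa_recursion:
  "asuesa_x f \<mu> L x0 0 = x0"
  "asuesa_v f \<mu> L x0 0 = long_step f \<mu> x0"
  "asuesa_x f \<mu> L x0 (Suc k) =
     asuesa_y f \<mu> L x0 k - (1 / L) *\<^sub>R grad f (asuesa_y f \<mu> L x0 k)"
  "asuesa_v f \<mu> L x0 (Suc k) =
     (1 - asuesa_alpha \<mu> L k) *\<^sub>R asuesa_v f \<mu> L x0 k
     + asuesa_alpha \<mu> L k *\<^sub>R long_step f \<mu> (asuesa_y f \<mu> L x0 k)"
  by (simp_all add: asuesa_x_def asuesa_v_def asuesa_y_def Let_def split_beta)

primrec asuesa_phi ::
  "('a::real_inner \<Rightarrow> real) \<Rightarrow> real \<Rightarrow> real \<Rightarrow> 'a \<Rightarrow> nat \<Rightarrow> 'a \<Rightarrow> real" where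
  "asuesa_phi f \<mu> L x0 0 = lower_model f \<mu> x0"
| "asuesa_phi f \<mu> L x0 (Suc k) =
     (\<lambda>x. (1 - asuesa_alpha \<mu> L k) * asuesa_phi f \<mu> L x0 k x
          + asuesa_alpha \<mu> L k * lower_model f \<mu> (asuesa_y f \<mu> L x0 k) x)"

definition attains_min :: "('a \<Rightarrow> real) \<Rightarrow> bool" where
  "attains_min g \<longleftrightarrow> (\<exists>x. \<forall>y. g x \<le> g y)"

text \<open>Unspecified unless \<open>attains_min g\<close>.\<close>
definition min_value :: "('a \<Rightarrow> real) \<Rightarrow> real" where
  "min_value g = (LEAST m. m \<in> range g)"

definition UES ::
  "('a \<Rightarrow> real) \<Rightarrow> (nat \<Rightarrow> 'a) \<Rightarrow> (nat \<Rightarrow> 'a \<Rightarrow> real) \<Rightarrow> (nat \<Rightarrow> real) \<Rightarrow> bool" where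
  "UES F x \<phi> \<alpha> \<longleftrightarrow>
     (\<forall>k. attains_min (\<phi> k)) \<and>
     (\<forall>k. 0 < \<alpha> k \<and> \<alpha> k < 1) \<and>
     (\<forall>z k. \<phi> k z \<le> F z) \<and>
     (\<forall>k. F (x (Suc k)) - min_value (\<phi> (Suc k)) \<le> (1 - \<alpha> k) * (F (x k) - min_value (\<phi> k)))"

end

theory Submission
  imports Defs
begin

text \<open>
  Completing the square turns \<open>lower_model f \<mu> y\<close> into the quadratic minorant of \<open>f\<close> at \<open>y\<close> that
  strong convexity provides.  Each \<open>\<phi>\<^sub>k\<close> is a convex combination of such minorants, so it stays
  below \<open>f\<close>.

  All these quadratics have the same Hessian \<open>\<mu> I\<close>, and so have their convex combinations:
  \<open>\<phi>\<^sub>k x = \<phi>\<^sub>k v\<^sub>k + \<mu>/2 \<parallel>x - v\<^sub>k\<parallel>\<^sup>2\<close>, where the minimisers combine with the same weights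
  as the functions, which is the recursion for \<open>v\<^sub>k\<close>.  Averaging two paraboloids with different
  minimisers \<open>u\<close> and \<open>w\<close> moreover lifts the minimum above the average of the
  two minima, by \<open>\<mu>/2 \<alpha>(1-\<alpha>) \<parallel>u - w\<parallel>\<^sup>2\<close>.

  With \<open>g = \<nabla>f(y\<^sub>k)\<close> and \<open>d = v\<^sub>k - y\<^sub>k\<close> this gain makes the minimum of the next model equal to
  \<open>(1-\<alpha>) \<phi>\<^sub>k\<^sup>* + \<alpha> f(y\<^sub>k) - \<alpha>\<^sup>2/(2\<mu>) \<parallel>g\<parallel>\<^sup>2 + \<alpha>(1-\<alpha>) (\<langle>d, g\<rangle> + \<mu>/2 \<parallel>d\<parallel>\<^sup>2)\<close>.
  The step sizes are tuned to this formula.  Since \<open>\<alpha>\<^sup>2/\<mu> = 1/L\<close>, the negative term is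
  exactly the decrease \<open>\<parallel>g\<parallel>\<^sup>2/(2L)\<close> that smoothness guarantees for the gradient step, and the two
  cancel in \<open>f(x\<^sub>k\<^sub>+\<^sub>1) - \<phi>\<^sub>k\<^sub>+\<^sub>1\<^sup>*\<close>.  Since \<open>\<beta> = 1/(1+\<alpha>)\<close>, the point \<open>y\<^sub>k\<close> divides the segment
  from \<open>x\<^sub>k\<close> to \<open>v\<^sub>k\<close> so that \<open>x\<^sub>k - y\<^sub>k = -\<alpha> d\<close>; hence \<open>-\<alpha> \<langle>d, g\<rangle>\<close> is the
  linear term of the minorant at \<open>y\<^sub>k\<close> evaluated at \<open>x\<^sub>k\<close>, and strong convexity absorbs it.
\<close>

lemma lower_model_completed_square:
  fixes f :: "'a::real_inner \<Rightarrow> real"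
  assumes "\<mu> \<noteq> 0"
  shows "lower_model f \<mu> y x = f y + grad f y \<bullet> (x - y) + \<mu> / 2 * (norm (x - y))\<^sup>2"
proof -
  have eq: "x - long_step f \<mu> y = (x - y) + (1 / \<mu>) *\<^sub>R grad f y"
    by (simp add: long_step_def)
  have "(norm (x - long_step f \<mu> y))\<^sup>2 =
      (norm (x - y))\<^sup>2 + 2 / \<mu> * (grad f y \<bullet> (x - y)) + (norm (grad f y))\<^sup>2 / \<mu>\<^sup>2"
    unfolding eq power2_norm_eq_inner
    by (simp add: inner_add_left inner_add_right inner_commute power2_eq_square)
  then show ?thesis
    using assms by (simp add: lower_model_def field_simps power2_eq_square)
qed

lemma lower_model_le:
  fixes f :: "'a::real_inner \<Rightarrow> real"
  assumes "\<mu> \<noteq> 0" and "strongly_convex \<mu> f"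
  shows "lower_model f \<mu> y x \<le> f x"
  using assms by (simp add: lower_model_completed_square strongly_convex_def)

text \<open>Smoothness bounds \<open>f\<close> along the ray \<open>y - t g\<close> by \<open>f y - t \<parallel>g\<parallel>\<^sup>2 + L t\<^sup>2 \<parallel>g\<parallel>\<^sup>2/2\<close>, and
  \<open>t = 1/L\<close> minimises this bound.\<close>
lemma gradient_step_decrease:
  fixes f :: "'a::real_inner \<Rightarrow> real"
  assumes "0 < L" and "smooth L f"
  shows "f (y - (1 / L) *\<^sub>R grad f y) \<le> f y - (norm (grad f y))\<^sup>2 / (2 * L)"
proof -
  define p where "p = y - (1 / L) *\<^sub>R grad f y"
  have d: "p - y = - (1 / L) *\<^sub>R grad f y" by (simp add: p_def)
  have "f p \<le> f y + grad f y \<bullet> (p - y) + L / 2 * (norm (p - y))\<^sup>2"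
    using assms(2) by (simp add: smooth_def)
  also have "\<dots> = f y - (norm (grad f y))\<^sup>2 / (2 * L)"
    unfolding d power2_norm_eq_inner using assms(1)
    by (simp add: field_simps)
  finally show ?thesis by (simp add: p_def)
qed

text \<open>The variance identity for a distribution on the two points \<open>u\<close> and \<open>w\<close>: the mean squared
  distance to \<open>x\<close> splits into the squared distance to the barycentre plus the variance.\<close>
lemma convex_combination_dist_squares:
  fixes u w x :: "'a::real_inner"
  shows "(1 - a) * (norm (x - u))\<^sup>2 + a * (norm (x - w))\<^sup>2 =
    (norm (x - ((1 - a) *\<^sub>R u + a *\<^sub>R w)))\<^sup>2 + a * (1 - a) * (norm (u - w))\<^sup>2"
  by (simp add: power2_norm_eq_inner inner_diff_left inner_diff_right inner_add_left
      inner_add_right inner_commute algebra_simps)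

lemma asuesa_phi_le:
  fixes f :: "'a::real_inner \<Rightarrow> real"
  assumes "0 < \<mu>" and "\<mu> \<le> L" and "strongly_convex \<mu> f"
  shows "asuesa_phi f \<mu> L x0 k x \<le> f x"
proof (induction k)
  case 0
  show ?case using assms lower_model_le[of \<mu> f] by simp
next
  case (Suc k)
  have "0 \<le> asuesa_alpha \<mu> L k" "asuesa_alpha \<mu> L k \<le> 1"
    using assms by (simp_all add: asuesa_alpha_def)
  then show ?case
    using assms Suc lower_model_le[of \<mu> f]
    by (simp add: convex_bound_le)
qed

text \<open>Subtracting the value at \<open>v\<^sub>k\<close> avoids carrying a separate sequence of constants through the
  induction: the variance terms cancel, as they do not depend on \<open>x\<close>.\<close>
lemma asuesa_phi_paraboloid:
  fixes f :: "'a::real_inner \<Rightarrow> real"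
  shows "asuesa_phi f \<mu> L x0 k x =
    asuesa_phi f \<mu> L x0 k (asuesa_v f \<mu> L x0 k) + \<mu> / 2 * (norm (x - asuesa_v f \<mu> L x0 k))\<^sup>2"
proof (induction k arbitrary: x)
  case 0
  show ?case by (simp add: asuesa_recursion lower_model_def)
next
  case (Suc k)
  define a where "a = asuesa_alpha \<mu> L k"
  define v where "v = asuesa_v f \<mu> L x0 k"
  define y where "y = asuesa_y f \<mu> L x0 k"
  define w where "w = long_step f \<mu> y"
  define v' where "v' = (1 - a) *\<^sub>R v + a *\<^sub>R w"
  define C where "C = (1 - a) * asuesa_phi f \<mu> L x0 k v
    + a * (f y - 1 / (2 * \<mu>) * (norm (grad f y))\<^sup>2) + \<mu> / 2 * (a * (1 - a) * (norm (v - w))\<^sup>2)"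
  have v': "asuesa_v f \<mu> L x0 (Suc k) = v'"
    by (simp add: asuesa_recursion v'_def a_def v_def w_def y_def)
  have phi: "asuesa_phi f \<mu> L x0 (Suc k) z = C + \<mu> / 2 * (norm (z - v'))\<^sup>2" for z
  proof -
    have "asuesa_phi f \<mu> L x0 (Suc k) z =
        (1 - a) * (asuesa_phi f \<mu> L x0 k v + \<mu> / 2 * (norm (z - v))\<^sup>2)
        + a * lower_model f \<mu> y z"
      using Suc[of z] by (simp add: a_def v_def y_def)
    also have "\<dots> = (1 - a) * asuesa_phi f \<mu> L x0 k v
        + a * (f y - 1 / (2 * \<mu>) * (norm (grad f y))\<^sup>2)
        + \<mu> / 2 * ((1 - a) * (norm (z - v))\<^sup>2 + a * (norm (z - w))\<^sup>2)"
      by (simp add: lower_model_def w_def distrib_left mult.left_commute)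
    also have "\<dots> = C + \<mu> / 2 * (norm (z - v'))\<^sup>2"
      unfolding convex_combination_dist_squares[of a z v w]
      by (simp add: C_def v'_def distrib_left)
    finally show ?thesis .
  qed
  show ?case unfolding v' using phi[of x] phi[of v'] by simp
qed

lemma asuesa_phi_minimiser:
  fixes f :: "'a::real_inner \<Rightarrow> real"
  assumes "0 \<le> \<mu>"
  shows "asuesa_phi f \<mu> L x0 k (asuesa_v f \<mu> L x0 k) \<le> asuesa_phi f \<mu> L x0 k x"
  using assms asuesa_phi_paraboloid[of f \<mu> L x0 k x] by simp

lemma min_value_eqI:
  assumes "\<And>x. g v \<le> g x"
  shows "min_value g = g v"
  unfolding min_value_def by (rule Least_equality) (use assms in auto)

text \<open>The new minimiser lies \<open>\<alpha>(w - v)\<close> away from \<open>v\<close> and \<open>(1-\<alpha>)(v - w)\<close> away from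
  \<open>w = long_step f \<mu> y\<close>, which yields the variance term \<open>\<mu>/2 \<alpha>(1-\<alpha>) \<parallel>v - w\<parallel>\<^sup>2\<close>; substituting
  \<open>v - w = (v - y) + g/\<mu>\<close> then leaves \<open>\<alpha>\<^sup>2\<close> in front of \<open>-\<parallel>g\<parallel>\<^sup>2/(2\<mu>)\<close>, where the
  minimum of the lower model by itself would contribute the weight \<open>\<alpha>\<close>.\<close>
lemma asuesa_phi_min_Suc:
  fixes f :: "'a::real_inner \<Rightarrow> real" and L :: real and x0 :: 'a and k :: nat
  assumes "\<mu> \<noteq> 0"
  defines "a \<equiv> asuesa_alpha \<mu> L k"
    and "v \<equiv> asuesa_v f \<mu> L x0 k"
    and "y \<equiv> asuesa_y f \<mu> L x0 k"
  shows "asuesa_phi f \<mu> L x0 (Suc k) (asuesa_v f \<mu> L x0 (Suc k)) =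
    (1 - a) * asuesa_phi f \<mu> L x0 k v + a * f y - a\<^sup>2 / (2 * \<mu>) * (norm (grad f y))\<^sup>2
    + a * (1 - a) * (grad f y \<bullet> (v - y) + \<mu> / 2 * (norm (v - y))\<^sup>2)"
proof -
  define w where "w = long_step f \<mu> y"
  define v' where "v' = (1 - a) *\<^sub>R v + a *\<^sub>R w"
  define g where "g = grad f y"
  have v': "asuesa_v f \<mu> L x0 (Suc k) = v'"
    by (simp add: asuesa_recursion v'_def a_def v_def w_def y_def)
  have "asuesa_phi f \<mu> L x0 (Suc k) v' =
      (1 - a) * (asuesa_phi f \<mu> L x0 k v + \<mu> / 2 * (norm (v' - v))\<^sup>2)
      + a * (f y - 1 / (2 * \<mu>) * (norm g)\<^sup>2 + \<mu> / 2 * (norm (v' - w))\<^sup>2)"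
    using asuesa_phi_paraboloid[of f \<mu> L x0 k v']
    by (simp add: lower_model_def a_def v_def y_def w_def g_def)
  also have "\<dots> = (1 - a) * asuesa_phi f \<mu> L x0 k v + a * (f y - 1 / (2 * \<mu>) * (norm g)\<^sup>2)
      + \<mu> / 2 * ((1 - a) * (norm (v' - v))\<^sup>2 + a * (norm (v' - w))\<^sup>2)"
    by (simp add: distrib_left mult.left_commute)
  also have "(1 - a) * (norm (v' - v))\<^sup>2 + a * (norm (v' - w))\<^sup>2 =
      a * (1 - a) * (norm (v - w))\<^sup>2"
    using convex_combination_dist_squares[of a v' v w] by (simp add: v'_def)
  also have "(norm (v - w))\<^sup>2 = (norm (v - y))\<^sup>2 + 2 / \<mu> * (g \<bullet> (v - y)) + (norm g)\<^sup>2 / \<mu>\<^sup>2"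
  proof -
    have eq: "v - w = (v - y) + (1 / \<mu>) *\<^sub>R g" by (simp add: w_def g_def long_step_def)
    show ?thesis
      unfolding eq power2_norm_eq_inner
      by (simp add: inner_add_left inner_add_right inner_commute power2_eq_square)
  qed
  also have "(1 - a) * asuesa_phi f \<mu> L x0 k v + a * (f y - 1 / (2 * \<mu>) * (norm g)\<^sup>2)
      + \<mu> / 2 * (a * (1 - a) *
          ((norm (v - y))\<^sup>2 + 2 / \<mu> * (g \<bullet> (v - y)) + (norm g)\<^sup>2 / \<mu>\<^sup>2)) =
      (1 - a) * asuesa_phi f \<mu> L x0 k v + a * f y - a\<^sup>2 / (2 * \<mu>) * (norm g)\<^sup>2
      + a * (1 - a) * (g \<bullet> (v - y) + \<mu> / 2 * (norm (v - y))\<^sup>2)"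
    using assms(1) by (simp add: field_simps power2_eq_square)
  finally show ?thesis unfolding v' g_def .
qed

lemma asuesa_x_minus_y:
  fixes f :: "'a::real_inner \<Rightarrow> real" and L :: real and k :: nat
  assumes "0 \<le> asuesa_alpha \<mu> L k"
  shows "asuesa_x f \<mu> L x0 k - asuesa_y f \<mu> L x0 k =
    - (asuesa_alpha \<mu> L k *\<^sub>R (asuesa_v f \<mu> L x0 k - asuesa_y f \<mu> L x0 k))"
proof -
  define a b x v where "a = asuesa_alpha \<mu> L k" and "b = asuesa_beta \<mu> L k"
    and "x = asuesa_x f \<mu> L x0 k" and "v = asuesa_v f \<mu> L x0 k"
  have b: "1 - b = a * b"
    using assms by (simp add: b_def a_def asuesa_beta_def field_simps)
  have y: "asuesa_y f \<mu> L x0 k = b *\<^sub>R x + (1 - b) *\<^sub>R v"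
    by (simp add: asuesa_y_def b_def x_def v_def)
  have "x - (b *\<^sub>R x + (1 - b) *\<^sub>R v) = (1 - b) *\<^sub>R (x - v)"
    by (simp add: algebra_simps)
  also have "\<dots> = - (a *\<^sub>R (b *\<^sub>R (v - x)))"
    unfolding b by (simp add: algebra_simps)
  also have "b *\<^sub>R (v - x) = v - (b *\<^sub>R x + (1 - b) *\<^sub>R v)"
    by (simp add: algebra_simps)
  finally show ?thesis by (simp add: y a_def x_def v_def)
qed

text \<open>After the cancellation of \<open>\<parallel>g\<parallel>\<^sup>2/(2L)\<close> the claim reduces to the minorant at \<open>y\<^sub>k\<close> evaluated at
  \<open>x\<^sub>k\<close>; both remaining quadratic terms have the favourable sign and are dropped.\<close>
lemma asuesa_gap_contraction:
  fixes f :: "'a::real_inner \<Rightarrow> real" and L :: real and k :: nat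
  assumes "0 < \<mu>" and "\<mu> \<le> L" and "strongly_convex \<mu> f" and "smooth L f"
  shows "f (asuesa_x f \<mu> L x0 (Suc k)) - asuesa_phi f \<mu> L x0 (Suc k) (asuesa_v f \<mu> L x0 (Suc k))
    \<le> (1 - asuesa_alpha \<mu> L k) *
      (f (asuesa_x f \<mu> L x0 k) - asuesa_phi f \<mu> L x0 k (asuesa_v f \<mu> L x0 k))"
proof -
  define a where "a = asuesa_alpha \<mu> L k"
  define x where "x = asuesa_x f \<mu> L x0 k"
  define v where "v = asuesa_v f \<mu> L x0 k"
  define y where "y = asuesa_y f \<mu> L x0 k"
  define g where "g = grad f y"
  define c where "c = asuesa_phi f \<mu> L x0 k v"
  define c' where "c' = asuesa_phi f \<mu> L x0 (Suc k) (asuesa_v f \<mu> L x0 (Suc k))"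
  have a: "0 \<le> a" "a \<le> 1" "a\<^sup>2 = \<mu> / L"
    using assms by (simp_all add: a_def asuesa_alpha_def)
  have L: "a\<^sup>2 / (2 * \<mu>) * (norm g)\<^sup>2 = (norm g)\<^sup>2 / (2 * L)"
    using assms a(3) by (simp add: field_simps)
  have c': "c' = (1 - a) * c + a * f y - (norm g)\<^sup>2 / (2 * L)
      + a * (1 - a) * (g \<bullet> (v - y) + \<mu> / 2 * (norm (v - y))\<^sup>2)"
    unfolding L[symmetric] c'_def
    using assms asuesa_phi_min_Suc[of \<mu> f L x0 k]
    by (simp add: a_def v_def y_def g_def c_def)
  have step: "f (asuesa_x f \<mu> L x0 (Suc k)) \<le> f y - (norm g)\<^sup>2 / (2 * L)"
    using assms gradient_step_decrease[of L f y]
    by (simp add: asuesa_recursion y_def g_def)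
  have xy: "x - y = - (a *\<^sub>R (v - y))"
    unfolding x_def y_def v_def a_def
    by (rule asuesa_x_minus_y) (use a in \<open>simp add: a_def\<close>)
  have "f y + g \<bullet> (x - y) + \<mu> / 2 * (norm (x - y))\<^sup>2 \<le> f x"
    using assms(3) by (simp add: strongly_convex_def g_def)
  moreover have "g \<bullet> (x - y) = - (a * (g \<bullet> (v - y)))"
    by (simp only: xy inner_minus_right inner_scaleR_right)
  moreover have "0 \<le> \<mu> / 2 * (norm (x - y))\<^sup>2" and q: "0 \<le> a * (\<mu> / 2 * (norm (v - y))\<^sup>2)"
    using assms a by simp_all
  ultimately have "f y - a * (g \<bullet> (v - y) + \<mu> / 2 * (norm (v - y))\<^sup>2) \<le> f x"
    by (simp only: distrib_left)
  then have "(1 - a) * (f y - a * (g \<bullet> (v - y) + \<mu> / 2 * (norm (v - y))\<^sup>2)) \<le> (1 - a) * f x"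
    using a by (intro mult_left_mono) auto
  then have "f (asuesa_x f \<mu> L x0 (Suc k)) - c' \<le> (1 - a) * (f x - c)"
    using step unfolding c' by (simp add: algebra_simps)
  then show ?thesis by (simp only: c'_def a_def x_def c_def v_def)
qed

theorem theorem4:
  fixes f :: "real ^ 'n \<Rightarrow> real" and \<mu> L :: real and x0 :: "real ^ 'n"
  assumes "0 < \<mu>" and "\<mu> < L"
    and "continuously_differentiable f"
    and "strongly_convex \<mu> f"
    and "smooth L f"
  shows "UES f (asuesa_x f \<mu> L x0) (asuesa_phi f \<mu> L x0) (asuesa_alpha \<mu> L)"
proof -
  have min: "asuesa_phi f \<mu> L x0 k (asuesa_v f \<mu> L x0 k) \<le> asuesa_phi f \<mu> L x0 k x" for k x
    using assms(1) by (intro asuesa_phi_minimiser) simp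
  then have min_value: "min_value (asuesa_phi f \<mu> L x0 k) =
      asuesa_phi f \<mu> L x0 k (asuesa_v f \<mu> L x0 k)" for k
    by (rule min_value_eqI)
  show ?thesis
    unfolding UES_def min_value
  proof (intro conjI allI)
    show "attains_min (asuesa_phi f \<mu> L x0 k)" for k
      using min unfolding attains_min_def by blast
    show "0 < asuesa_alpha \<mu> L k" "asuesa_alpha \<mu> L k < 1" for k
      using assms by (simp_all add: asuesa_alpha_def)
    show "asuesa_phi f \<mu> L x0 k z \<le> f z" for z k
      using assms by (intro asuesa_phi_le) auto
  qed (use assms in \<open>auto intro!: asuesa_gap_contraction simp del: asuesa_phi.simps\<close>)
qed

end
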